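(* Suppose $\mathcal{H}$ is a hypothesis space. Given two hypotheses $h_1,h_2\in\mathcal{H}$ and their probabilistic outputs $\boldsymbol{p}_1,\boldsymbol{p}_2\in\Delta_K$, the Classifier Determinacy Disparity $\Gamma(\boldsymbol{p}_1,\boldsymbol{p}_2)$ is a pseudometric.
   Context: $\Delta_K=\{\boldsymbol{p}\in\mathbb{R}^K: p^k\ge 0,\ \sum_{k=1}^K p^k=1\}$ is the set of probability vectors over $K$ classes, and each hypothesis $h\in\mathcal{H}$ outputs (via softmax) a vector $\boldsymbol{p}\in\Delta_K$ on each input. Classifier Determinacy Disparity (CDD): for $\boldsymbol{p}_1,\boldsymbol{p}_2\in\Delta_K$ let $\mathbf{A}=\boldsymbol{p}_1\boldsymbol{p}_2^\top\in\mathbb{R}^{K\times K}$, so $A_{mn}=p_1^m p_2^n$, and define $$\Gamma(\boldsymbol{p}_1,\boldsymbol{p}_2)=\sum_{m,n=1}^K A_{mn}-\sum_{m=1}^K A_{mm}=\sum_{m\ne n}A_{mn}.$$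
   Formalization: "Pseudometric" here means nonnegative, symmetric and satisfying the triangle inequality; the usual axiom Γ(p,p)=0 is dropped because it is false for K≥2 (e.g. Γ(p,p)=1/2 for p=(1/2,1/2)), holding only for one-hot p. *)

theory Defs
  imports "HOL-Analysis.Analysis"
begin

definition prob_vectors :: "(real ^ 'k) set" where
  "prob_vectors = {p. (\<forall>k. 0 \<le> p $ k) \<and> (\<Sum>k\<in>UNIV. p $ k) = 1}"

definition outer_product :: "real ^ 'k \<Rightarrow> real ^ 'k \<Rightarrow> real ^ 'k ^ 'k" where
  "outer_product p q = (\<chi> m n. p $ m * q $ n)"

definition CDD :: "real ^ 'k \<Rightarrow> real ^ 'k \<Rightarrow> real" where
  "CDD p q = (let A = outer_product p q
              in (\<Sum>m\<in>UNIV. \<Sum>n\<in>UNIV. A $ m $ n) - (\<Sum>m\<in>UNIV. A $ m $ m))"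

lemma CDD_off_diagonal:
  fixes p q :: "real ^ 'k"
  shows "CDD p q = (\<Sum>(m, n) \<in> {(m, n). m \<noteq> n}. outer_product p q $ m $ n)"
proof -
  let ?A = "outer_product p q"
  let ?f = "\<lambda>(m, n). ?A $ m $ n"
  have U: "(UNIV :: ('k \<times> 'k) set) = {(m, n). m \<noteq> n} \<union> (\<lambda>m. (m, m)) ` UNIV"
    by auto
  have "(\<Sum>m\<in>UNIV. \<Sum>n\<in>UNIV. ?A $ m $ n) = sum ?f UNIV"
    by (simp add: sum.cartesian_product)
  also have "\<dots> = sum ?f {(m, n). m \<noteq> n} + sum ?f ((\<lambda>m. (m, m)) ` UNIV)"
    by (subst U, rule sum.union_disjoint) auto
  also have "sum ?f ((\<lambda>m. (m, m)) ` UNIV) = (\<Sum>m\<in>UNIV. ?A $ m $ m)"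
    by (subst sum.reindex) (auto simp: inj_on_def)
  finally show ?thesis
    by (simp add: CDD_def Let_def)
qed

text \<open>
  Here a pseudometric is a nonnegative, symmetric function that satisfies the triangle
  inequality. The axiom \<open>d x x = 0\<close>, which many authors also require, is NOT included: it fails
  for \<open>CDD\<close> on probability vectors (see \<open>CDD_self_eq_0_iff\<close> and \<open>CDD_self_nonzero\<close> below).
\<close>

definition pseudometric_on :: "'a set \<Rightarrow> ('a \<Rightarrow> 'a \<Rightarrow> real) \<Rightarrow> bool" where
  "pseudometric_on S d \<longleftrightarrow>
     (\<forall>x\<in>S. \<forall>y\<in>S. 0 \<le> d x y) \<and>
     (\<forall>x\<in>S. \<forall>y\<in>S. d x y = d y x) \<and>
     (\<forall>x\<in>S. \<forall>y\<in>S. \<forall>z\<in>S. d x z \<le> d x y + d y z)"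

lemma CDD_self_eq_0_iff:
  fixes p :: "real ^ 'k"
  assumes "p \<in> prob_vectors"
  shows "CDD p p = 0 \<longleftrightarrow> (\<exists>k. p = axis k 1)"
proof
  have nn: "0 \<le> p $ k" for k
    using assms by (simp add: prob_vectors_def)
  have s1: "(\<Sum>k\<in>UNIV. p $ k) = 1"
    using assms by (simp add: prob_vectors_def)
  assume "CDD p p = 0"
  then have "(\<Sum>(m, n) \<in> {(m, n). m \<noteq> n}. p $ m * p $ n) = 0"
    by (simp add: CDD_off_diagonal outer_product_def)
  then have z: "p $ m * p $ n = 0" if "m \<noteq> n" for m n
    using that nn by (subst (asm) sum_nonneg_eq_0_iff) auto
  obtain k where k: "p $ k \<noteq> 0"
    using s1 by (metis sum.neutral zero_neq_one)
  then have off: "p $ n = 0" if "n \<noteq> k" for n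
    using z[of k n] that by auto
  have "(\<Sum>n\<in>UNIV. p $ n) = (\<Sum>n\<in>{k}. p $ n)"
    by (rule sum.mono_neutral_right) (auto simp: off)
  then have "p = axis k 1"
    using s1 off by (auto simp: vec_eq_iff axis_def)
  then show "\<exists>k. p = axis k 1" ..
next
  assume "\<exists>k. p = axis k 1"
  then show "CDD p p = 0"
    by (auto simp: CDD_off_diagonal outer_product_def axis_def intro!: sum.neutral)
qed

lemma CDD_self_nonzero:
  assumes "CARD('k) \<ge> 2"
  shows "\<exists>p \<in> (prob_vectors :: (real ^ 'k) set). CDD p p \<noteq> 0"
proof
  let ?p = "(\<chi> k. 1 / real CARD('k)) :: real ^ 'k"
  show p: "?p \<in> prob_vectors"
    by (simp add: prob_vectors_def)
  have "?p \<noteq> axis k 1" for k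
  proof
    assume "?p = axis k 1"
    then have "?p $ k = axis k 1 $ k"
      by (rule arg_cong)
    with assms show False
      by (simp add: axis_def)
  qed
  then show "CDD ?p ?p \<noteq> 0"
    using CDD_self_eq_0_iff[OF p] by blast
qed

end

(* On probability vectors CDD p q = 1 - p \<bullet> q, so the triangle inequality reads
   (p + r) \<bullet> q \<le> 1 + p \<bullet> r. The left side is a q-weighted average of the numbers
   p $ k + r $ k, and each of them is at most 1 + p $ k * r $ k because
   (1 - p $ k) * (1 - r $ k) \<ge> 0. *)

theory Submission
  imports Defs
begin

text \<open>The sum of all entries of the outer product factors into the two total masses and so
  equals 1, while its trace is the inner product.\<close>

lemma CDD_eq_one_minus_inner:
  assumes "p \<in> prob_vectors" "q \<in> prob_vectors"
  shows "CDD p q = 1 - p \<bullet> q"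
proof -
  have "(\<Sum>m\<in>UNIV. \<Sum>n\<in>UNIV. p $ m * q $ n) = (\<Sum>m\<in>UNIV. p $ m) * (\<Sum>n\<in>UNIV. q $ n)"
    by (simp add: sum_product)
  with assms show ?thesis
    by (simp add: CDD_def outer_product_def inner_vec_def prob_vectors_def)
qed

lemma prob_vectors_nth_le_1:
  assumes "p \<in> prob_vectors"
  shows "p $ k \<le> 1"
  using assms member_le_sum[of k UNIV "\<lambda>k. p $ k"] by (simp add: prob_vectors_def)

lemma prob_vectors_nth_add_le:
  assumes p: "p \<in> prob_vectors" and r: "r \<in> prob_vectors"
  shows "p $ k + r $ k \<le> 1 + p \<bullet> r"
proof -
  have "0 \<le> (1 - p $ k) * (1 - r $ k)"
    using p r by (simp add: prob_vectors_nth_le_1)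
  then have "p $ k + r $ k \<le> 1 + p $ k * r $ k"
    by (simp add: algebra_simps)
  \<comment> \<open>One term of a sum of nonnegative terms is at most the whole sum.\<close>
  also have "p $ k * r $ k \<le> p \<bullet> r"
    using p r member_le_sum[of k UNIV "\<lambda>k. p $ k * r $ k"]
    by (simp add: inner_vec_def prob_vectors_def)
  finally show ?thesis by simp
qed

text \<open>The weights \<open>q $ k\<close> are nonnegative with sum 1, so the average of
  \<open>v\<close> stays below any common bound \<open>c\<close> of its coordinates. This serves
  both nonnegativity and the triangle inequality.\<close>

lemma inner_prob_vectors_le:
  assumes q: "q \<in> prob_vectors" and le: "\<And>k. v $ k \<le> c"
  shows "v \<bullet> q \<le> c"
proof -
  have "v \<bullet> q \<le> (\<Sum>k\<in>UNIV. c * q $ k)"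
    using q le by (auto simp: inner_vec_def prob_vectors_def intro!: sum_mono mult_right_mono)
  also have "\<dots> = c"
    using q by (simp add: prob_vectors_def flip: sum_distrib_left)
  finally show ?thesis .
qed

lemma CDD_nonneg:
  assumes "p \<in> prob_vectors" "q \<in> prob_vectors"
  shows "0 \<le> CDD p q"
  \<comment> \<open>Averaging the coordinates of \<open>p\<close>, each at most 1, gives
    \<open>p \<bullet> q \<le> 1\<close>.\<close>
  using inner_prob_vectors_le[of q p 1] assms
  by (simp add: CDD_eq_one_minus_inner prob_vectors_nth_le_1)

lemma CDD_commute:
  assumes "p \<in> prob_vectors" "q \<in> prob_vectors"
  shows "CDD p q = CDD q p"
  using assms by (simp add: CDD_eq_one_minus_inner inner_commute)

lemma CDD_triangle:
  assumes "p \<in> prob_vectors" "q \<in> prob_vectors" "r \<in> prob_vectors"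
  shows "CDD p r \<le> CDD p q + CDD q r"
proof -
  \<comment> \<open>The middle point \<open>q\<close> supplies the weights; the averaged vector is
    \<open>p + r\<close>.\<close>
  have "(p + r) \<bullet> q \<le> 1 + p \<bullet> r"
    using assms by (intro inner_prob_vectors_le) (simp_all add: prob_vectors_nth_add_le)
  with assms show ?thesis
    by (simp add: CDD_eq_one_minus_inner inner_add_left inner_commute[of q r])
qed

lemma pseudometric_on_CDD: "pseudometric_on prob_vectors CDD"
  unfolding pseudometric_on_def by (intro conjI ballI CDD_nonneg CDD_commute CDD_triangle)

text \<open>Carries the result from probability vectors to hypotheses: each axiom for
  \<open>x\<close>, \<open>y\<close>, \<open>z\<close> in \<open>T\<close> is the axiom of
  \<open>d\<close> at their images in \<open>S\<close>.\<close>

lemma pseudometric_on_pullback: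
  assumes "pseudometric_on S d" "\<And>x. x \<in> T \<Longrightarrow> f x \<in> S"
  shows "pseudometric_on T (\<lambda>x y. d (f x) (f y))"
  using assms unfolding pseudometric_on_def by blast

theorem proposition3:
  fixes H :: "('x \<Rightarrow> real ^ 'k) set"
  assumes outputs: "\<And>h x. h \<in> H \<Longrightarrow> h x \<in> prob_vectors"
  shows "pseudometric_on (prob_vectors :: (real ^ 'k) set) CDD \<and>
         (\<forall>x. pseudometric_on H (\<lambda>h\<^sub>1 h\<^sub>2. CDD (h\<^sub>1 x) (h\<^sub>2 x)))"
proof (intro conjI allI)
  show "pseudometric_on prob_vectors CDD"
    by (rule pseudometric_on_CDD)
  show "pseudometric_on H (\<lambda>h\<^sub>1 h\<^sub>2. CDD (h\<^sub>1 x) (h\<^sub>2 x))" for x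
    \<comment> \<open>The map pulled back along is evaluation at the fixed input
      \<open>x\<close>.\<close>
    by (rule pseudometric_on_pullback[OF pseudometric_on_CDD, where f = "\<lambda>h. h x"]) (rule outputs)
qed

end
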